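(* Let $T$ be a densely defined closed operator with domain $D(T)\subset H$, $H$ a complex Hilbert space, such that $T^*T=p(T)$, where $p(z)$ is a complex polynomial of degree $n\geq 1$. Then the following assertions hold: (1) $T$ is quasinormal. (2) If $n\neq 2$, then $T\in B(H)$. (3) Let $n=2$. Assume that $p(z)$ has the property that whenever $z\in\mathbb{C}$ is such that $p(z)\geq 0$ (that is, $p(z)$ is real and nonnegative), then $z\in\mathbb{R}$. Then $T$ is self-adjoint.
   Context: All operators are linear and possibly unbounded. Sums and products carry their natural domains: $D(A+B)=D(A)\cap D(B)$, $D(AB)=\{x\in D(B):Bx\in D(A)\}$; in particular $D[p(T)]=D(T^n)$. Equality of operators includes equality of domains. $B(H)$ is the set of bounded everywhere defined operators on $H$. A linear operator $T$ is quasinormal if it is closed, densely defined, and $TT^*T=T^*TT$. *)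

theory Defs
  imports "HOL-Analysis.Analysis" "HOL-Computational_Algebra.Polynomial"
begin

section \<open>Complex Hilbert spaces\<close>

text \<open>
  A complex inner product, linear in the first argument. The class extends
  \<^class>\<open>real_inner\<close> by requiring that the real inner product is the real part of the complex
  one. Hence the norm is the one induced by \<open>cinner\<close>, and positive definiteness of \<open>cinner\<close> is
  inherited (lemmas \<open>cinner_self\<close> and \<open>norm_eq_sqrt_cinner\<close> below).
\<close>

class complex_inner = real_inner +
  fixes scaleC :: "complex \<Rightarrow> 'a \<Rightarrow> 'a"  (infixr "*\<^sub>C" 75)
    and cinner :: "'a \<Rightarrow> 'a \<Rightarrow> complex"
  assumes scaleC_add_right: "a *\<^sub>C (x + y) = a *\<^sub>C x + a *\<^sub>C y"
    and scaleC_add_left: "(a + b) *\<^sub>C x = a *\<^sub>C x + b *\<^sub>C x"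
    and scaleC_scaleC: "a *\<^sub>C (b *\<^sub>C x) = (a * b) *\<^sub>C x"
    and scaleC_of_real: "complex_of_real r *\<^sub>C x = r *\<^sub>R x"
    and cinner_commute: "cinner x y = cnj (cinner y x)"
    and cinner_add_left: "cinner (x + y) z = cinner x z + cinner y z"
    and cinner_scaleC_left: "cinner (a *\<^sub>C x) y = a * cinner x y"
    and inner_eq_Re_cinner: "inner x y = Re (cinner x y)"

class complex_hilbert = complex_inner + complete_space

lemma cinner_self:
  fixes x :: "'a::complex_inner"
  shows "cinner x x = complex_of_real ((norm x)\<^sup>2)"
proof -
  have "Im (cinner x x) = 0"
    using arg_cong[OF cinner_commute[of x x], of Im] by simp
  then show ?thesis
    by (simp add: complex_eq_iff power2_norm_eq_inner inner_eq_Re_cinner)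
qed

lemma norm_eq_sqrt_cinner:
  fixes x :: "'a::complex_inner"
  shows "norm x = sqrt (cmod (cinner x x))"
  by (simp add: cinner_self norm_power)

instantiation complex :: complex_hilbert
begin

definition "scaleC_complex (a::complex) (x::complex) = a * x"
definition "cinner_complex (x::complex) (y::complex) = x * cnj y"

instance
  by standard
    (auto simp: scaleC_complex_def cinner_complex_def algebra_simps inner_complex_def
      scaleR_conv_of_real)

end


section \<open>Unbounded operators\<close>

text \<open>
  An operator is represented by its graph. Its domain is then \<^const>\<open>Domain\<close>, equality of sets is
  equality of operators including equality of domains, \<^const>\<open>closed\<close> in the product topology is
  closedness of the operator, \<open>T ^^ k\<close> is the \<open>k\<close>-th power (with \<open>T ^^ 0\<close> the identity on all
  of the space), and relation composition yields the natural domain of a product.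
\<close>

type_synonym 'a op = "('a \<times> 'a) set"

definition linear_op :: "'a::complex_inner op \<Rightarrow> bool" where
  "linear_op T \<longleftrightarrow>
     single_valued T \<and>
     (0, 0) \<in> T \<and>
     (\<forall>x y x' y'. (x, y) \<in> T \<longrightarrow> (x', y') \<in> T \<longrightarrow> (x + x', y + y') \<in> T) \<and>
     (\<forall>c x y. (x, y) \<in> T \<longrightarrow> (c *\<^sub>C x, c *\<^sub>C y) \<in> T)"

definition densely_defined :: "'a::complex_inner op \<Rightarrow> bool" where
  "densely_defined T \<longleftrightarrow> closure (Domain T) = UNIV"

text \<open>The product \<open>A B\<close>: first \<open>B\<close>, then \<open>A\<close>, whereas \<open>(O)\<close> composes in diagrammatic order.\<close>

definition op_mult :: "'a op \<Rightarrow> 'a op \<Rightarrow> 'a op"  (infixl "\<cdot>\<^sub>o" 70) where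
  "A \<cdot>\<^sub>o B = B O A"

text \<open>
  \<open>T\<^sup>* y = z\<close> iff \<open>\<langle>T x, y\<rangle> = \<langle>x, z\<rangle>\<close> for all \<open>x\<close> in the domain of \<open>T\<close>; it is the graph of a
  function if \<open>T\<close> is densely defined (lemma \<open>single_valued_op_adj\<close> below).
\<close>

definition op_adj :: "'a::complex_inner op \<Rightarrow> 'a op" where
  "op_adj T = {(y, z). \<forall>(x, w) \<in> T. cinner w y = cinner x z}"

text \<open>
  \<open>p(T) = a\<^sub>0 I + a\<^sub>1 T + \<dots> + a\<^sub>n T\<^sup>n\<close>, \<open>n = deg p\<close>, where \<open>y k = T\<^sup>k x\<close>. The natural domain of the sum is
  the intersection of the domains of all powers up to \<open>n\<close>, whether or not some of the lower
  coefficients vanish, and so equals the domain of \<open>T\<^sup>n\<close> (lemma \<open>Domain_op_poly\<close> below).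
\<close>

definition op_poly :: "complex poly \<Rightarrow> 'a::complex_inner op \<Rightarrow> 'a op" where
  "op_poly p T =
     {(x, \<Sum>k\<le>degree p. coeff p k *\<^sub>C y k) | x y. \<forall>k\<le>degree p. (x, y k) \<in> T ^^ k}"

definition bounded_op :: "'a::complex_inner op \<Rightarrow> bool" where
  "bounded_op T \<longleftrightarrow>
     linear_op T \<and> Domain T = UNIV \<and> (\<exists>K. \<forall>(x, y) \<in> T. norm y \<le> K * norm x)"

definition self_adjoint_op :: "'a::complex_inner op \<Rightarrow> bool" where
  "self_adjoint_op T \<longleftrightarrow> linear_op T \<and> densely_defined T \<and> op_adj T = T"

definition quasinormal_op :: "'a::complex_inner op \<Rightarrow> bool" where
  "quasinormal_op T \<longleftrightarrow>
     linear_op T \<and> closed T \<and> densely_defined T \<and>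
     T \<cdot>\<^sub>o op_adj T \<cdot>\<^sub>o T = op_adj T \<cdot>\<^sub>o T \<cdot>\<^sub>o T"

lemma Domain_op_mult: "Domain (A \<cdot>\<^sub>o B) = {x. \<exists>y. (x, y) \<in> B \<and> y \<in> Domain A}"
  by (auto simp: op_mult_def)

lemma Domain_op_poly: "Domain (op_poly p T) = Domain (T ^^ degree p)"
proof
  show "Domain (op_poly p T) \<subseteq> Domain (T ^^ degree p)"
    by (auto simp: op_poly_def)
next
  show "Domain (T ^^ degree p) \<subseteq> Domain (op_poly p T)"
  proof
    fix x assume "x \<in> Domain (T ^^ degree p)"
    then obtain z where z: "(x, z) \<in> T ^^ degree p" by blast
    have "\<exists>y. (x, y) \<in> T ^^ k" if "k \<le> degree p" for k
    proof -
      have "T ^^ degree p = T ^^ k O T ^^ (degree p - k)"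
        using that by (metis le_add_diff_inverse relpow_add)
      then show ?thesis using z by blast
    qed
    then have "\<forall>k\<in>{..degree p}. \<exists>y. (x, y) \<in> T ^^ k" by auto
    from bchoice[OF this] obtain y where "\<forall>k\<le>degree p. (x, y k) \<in> T ^^ k" by auto
    then show "x \<in> Domain (op_poly p T)"
      unfolding op_poly_def by blast
  qed
qed

lemma single_valued_op_adj:
  assumes "densely_defined T"
  shows "single_valued (op_adj T)"
proof (rule single_valuedI)
  fix y z z' assume zs: "(y, z) \<in> op_adj T" "(y, z') \<in> op_adj T"
  have eq: "inner x z = inner x z'" if "x \<in> Domain T" for x
    using zs that by (auto simp: op_adj_def inner_eq_Re_cinner) (metis (lifting) case_prodD)+
  have "closed {x. inner x z = inner x z'}"
    by (intro closed_Collect_eq continuous_intros)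
  then have "closure (Domain T) \<subseteq> {x. inner x z = inner x z'}"
    using eq by (intro closure_minimal) auto
  then have "inner x z = inner x z'" for x
    using assms by (auto simp: densely_defined_def)
  then show "z = z'" using vector_eq_ldot[of z z'] by (simp add: inner_commute)
qed

end

theory Submission
  imports Defs
begin

text \<open>
  Put \<open>A = T\<^sup>* T = p(T)\<close>. A polynomial in \<open>T\<close> commutes with \<open>T\<close>, domains included, which is (1), and
  \<open>A T = T A\<close> gives \<open>\<parallel>T\<^sup>2 x\<parallel> = \<parallel>A x\<parallel>\<close>; hence the norms \<open>\<parallel>T\<^sup>k x\<parallel>\<close> are log-convex in \<open>k\<close>. For \<open>n \<ge> 3\<close>, a
  large ratio \<open>\<parallel>T x\<parallel> / \<parallel>x\<parallel>\<close> would make \<open>\<parallel>T\<^sup>n x\<parallel>\<close> too large for \<open>\<parallel>p(T) x\<parallel> = \<parallel>T\<^sup>2 x\<parallel>\<close>, so \<open>T\<close> is bounded on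
  the dense domain of \<open>A\<^sup>2\<close>. For \<open>n = 1\<close>, \<open>\<parallel>T x\<parallel>\<^sup>2 = \<langle>p(T) x, x\<rangle>\<close> suffices. For \<open>n = 2\<close>, the hypothesis
  forces \<open>p = az\<^sup>2 + bz + c\<close> to be real with \<open>a > 0\<close> and \<open>b\<^sup>2 \<ge> 4ac\<close>. The form
  \<open>f(x, y) = \<langle>T x, y\<rangle> - \<langle>x, T y\<rangle>\<close> satisfies \<open>f(A x, y) = \<gamma> f(x, y)\<close> with \<open>\<gamma> = c/(1 + a)\<close>, and \<open>T\<close>
  vanishes on \<open>ker (A - \<gamma>)\<close>; smoothing by the resolvent of \<open>A\<close> turns \<open>f\<close> into a bounded form, and
  \<open>f = 0\<close> follows. A symmetric \<open>T\<close> with \<open>D(T\<^sup>* T) = D(T\<^sup>2)\<close> is self-adjoint because \<open>T\<^sup>2 + 1\<close> is onto.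

  Real inner products suffice for everything but the coefficients of \<open>p\<close>.
\<close>

section \<open>Closed operators on a real Hilbert space\<close>

text \<open>A minimizing sequence for the distance to \<open>M\<close> is Cauchy by the
  parallelogram law. Its limit \<open>m\<close> is a closest point, and comparing \<open>m\<close>
  with \<open>m + c *\<^sub>R u\<close> forces orthogonality.\<close>

lemma orthogonal_projection_ex:
  fixes M :: "'a::{real_inner,complete_space} set"
  assumes M: "subspace M" "closed M"
  obtains m where "m \<in> M" "\<And>u. u \<in> M \<Longrightarrow> inner (x - m) u = 0"
proof -
  define \<delta> where "\<delta> = (INF m\<in>M. (norm (x - m))\<^sup>2)"
  have "0 \<in> M" using M(1) by (rule subspace_0)
  have bdd: "bdd_below ((\<lambda>m. (norm (x - m))\<^sup>2) ` M)"
    by (rule bdd_belowI2[of _ 0]) simp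
  have \<delta>_le: "\<delta> \<le> (norm (x - m))\<^sup>2" if "m \<in> M" for m
    unfolding \<delta>_def using bdd that by (rule cINF_lower)
  have "\<exists>m\<in>M. (norm (x - m))\<^sup>2 < \<delta> + inverse (real (Suc i))" for i
  proof -
    have "\<delta> < \<delta> + inverse (real (Suc i))" by simp
    then show ?thesis
      unfolding \<delta>_def using cINF_less_iff[OF _ bdd] \<open>0 \<in> M\<close> by blast
  qed
  then obtain s where s: "s i \<in> M" "(norm (x - s i))\<^sup>2 < \<delta> + inverse (real (Suc i))" for i
    by metis
  have close: "(norm (s i - s j))\<^sup>2 \<le> 2 * inverse (real (Suc i)) + 2 * inverse (real (Suc j))" for i j
  proof -
    have "(1/2) *\<^sub>R (s i + s j) \<in> M"
      using s M(1) by (simp add: subspace_add subspace_scale)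
    then have "\<delta> \<le> (norm (x - (1/2) *\<^sub>R (s i + s j)))\<^sup>2" by (rule \<delta>_le)
    moreover have "(norm (s i - s j))\<^sup>2 = 2 * (norm (x - s i))\<^sup>2 + 2 * (norm (x - s j))\<^sup>2
        - 4 * (norm (x - (1/2) *\<^sub>R (s i + s j)))\<^sup>2"
      by (simp add: power2_norm_eq_inner inner_simps inner_commute algebra_simps)
    ultimately show ?thesis using s(2)[of i] s(2)[of j] by linarith
  qed
  have "Cauchy s"
  proof (rule metric_CauchyI)
    fix e :: real assume "e > 0"
    then obtain N where N: "inverse (real (Suc N)) < e\<^sup>2 / 4"
      using reals_Archimedean[of "e\<^sup>2 / 4"] by auto
    have "dist (s i) (s j) < e" if "i \<ge> N" "j \<ge> N" for i j
    proof -
      have "inverse (real (Suc i)) \<le> inverse (real (Suc N))" "inverse (real (Suc j)) \<le> inverse (real (Suc N))"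
        using that by (simp_all add: field_simps)
      then have "(norm (s i - s j))\<^sup>2 < e\<^sup>2" using close[of i j] N by linarith
      then show ?thesis using \<open>e > 0\<close> by (simp add: dist_norm power_less_imp_less_base)
    qed
    then show "\<exists>N. \<forall>i\<ge>N. \<forall>j\<ge>N. dist (s i) (s j) < e" by blast
  qed
  then obtain m where lim: "s \<longlonglongrightarrow> m" using Cauchy_convergent convergent_def by blast
  have "m \<in> M" using M(2) s(1) lim by (rule closed_sequentially)
  have "(\<lambda>i. (norm (x - s i))\<^sup>2) \<longlonglongrightarrow> (norm (x - m))\<^sup>2"
    by (intro tendsto_intros lim)
  moreover have "(\<lambda>i. \<delta> + inverse (real (Suc i))) \<longlonglongrightarrow> \<delta> + 0"
    by (intro tendsto_intros LIMSEQ_inverse_real_of_nat)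
  ultimately have m_le: "(norm (x - m))\<^sup>2 \<le> \<delta>"
    using s(2) by (intro LIMSEQ_le[of _ _ _ \<delta>]) (auto intro: less_imp_le)
  have "inner (x - m) u = 0" if "u \<in> M" for u
  proof (cases "u = 0")
    case False
    \<comment> \<open>This \<open>c\<close> minimizes the distance from \<open>x\<close> to
      \<open>m + c *\<^sub>R u\<close>.\<close>
    define c where "c = inner (x - m) u / (norm u)\<^sup>2"
    have "m + c *\<^sub>R u \<in> M" using M(1) \<open>m \<in> M\<close> that by (simp add: subspace_add subspace_scale)
    then have "(norm (x - m))\<^sup>2 \<le> (norm (x - m - c *\<^sub>R u))\<^sup>2"
      using \<delta>_le m_le by (smt (verit) diff_diff_eq)
    also have "\<dots> = (norm (x - m))\<^sup>2 - 2 * c * inner (x - m) u + c\<^sup>2 * (norm u)\<^sup>2"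
      unfolding power2_norm_eq_inner
      by (simp add: inner_diff inner_commute algebra_simps power2_eq_square)
    also have "\<dots> = (norm (x - m))\<^sup>2 - (inner (x - m) u)\<^sup>2 / (norm u)\<^sup>2"
      using False by (simp add: c_def field_simps power2_eq_square)
    finally have "(inner (x - m) u)\<^sup>2 \<le> 0" using False by (simp add: field_simps)
    then show ?thesis by simp
  qed simp
  with \<open>m \<in> M\<close> show thesis by (rule that)
qed

lemma subspace_closure:
  fixes S :: "'a::real_normed_vector set"
  assumes S: "subspace S"
  shows "subspace (closure S)"
  unfolding subspace_def
proof (intro conjI ballI allI)
  show "0 \<in> closure S" using S closure_subset subspace_0 by blast
next
  fix x y assume "x \<in> closure S" "y \<in> closure S"
  then obtain f g where "\<And>i. f i \<in> S" "f \<longlonglongrightarrow> x" "\<And>i. g i \<in> S" "g \<longlonglongrightarrow> y"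
    unfolding closure_sequential by blast
  then show "x + y \<in> closure S"
    unfolding closure_sequential using S
    by (intro exI[of _ "\<lambda>i. f i + g i"]) (simp add: subspace_add tendsto_add)
next
  fix c x assume "x \<in> closure S"
  then obtain f where "\<And>i. f i \<in> S" "f \<longlonglongrightarrow> x" unfolding closure_sequential by blast
  then show "c *\<^sub>R x \<in> closure S"
    unfolding closure_sequential using S
    by (intro exI[of _ "\<lambda>i. c *\<^sub>R f i"]) (simp add: subspace_scale tendsto_scaleR)
qed

lemma orthogonal_dense_eq_0:
  fixes z :: "'a::real_inner"
  assumes "closure S = UNIV" "\<And>v. v \<in> S \<Longrightarrow> inner v z = 0"
  shows "z = 0"
proof -
  have "closed {v. inner v z = 0}" by (intro closed_Collect_eq continuous_intros)
  then have "closure S \<subseteq> {v. inner v z = 0}" using assms(2) by (intro closure_minimal) auto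
  then have "z \<in> {v. inner v z = 0}" using assms(1) by blast
  then show ?thesis by simp
qed

section \<open>Closed densely defined operators and \<open>A = T\<^sup>* T\<close>\<close>

locale closed_operator =
  fixes D :: "'a::{real_inner,complete_space} set" and t :: "'a \<Rightarrow> 'a"
  assumes subspace_D: "subspace D"
    and t_add: "x \<in> D \<Longrightarrow> y \<in> D \<Longrightarrow> t (x + y) = t x + t y"
    and t_scale: "x \<in> D \<Longrightarrow> t (c *\<^sub>R x) = c *\<^sub>R t x"
    and closed_graph: "closed {(x, t x) | x. x \<in> D}"
    and dense_D: "closure D = UNIV"
begin

text \<open>A relation, since a given \<open>y\<close> may have no \<open>z\<close>. For
  complex-linear operators it agrees with \<open>op_adj\<close> (\<open>op_adj_iff\<close>).\<close>

definition adj :: "'a \<Rightarrow> 'a \<Rightarrow> bool" where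
  "adj y z \<longleftrightarrow> (\<forall>v\<in>D. inner (t v) y = inner v z)"

text \<open>\<open>A\<close> is \<open>T\<^sup>* T\<close> and \<open>E\<close> is its domain; \<open>A x\<close> is a junk value for \<open>x \<notin> E\<close>.\<close>

definition A :: "'a \<Rightarrow> 'a" where "A x = (THE z. adj (t x) z)"

definition E :: "'a set" where "E = {x \<in> D. \<exists>z. adj (t x) z}"

lemma D_add: "x \<in> D \<Longrightarrow> y \<in> D \<Longrightarrow> x + y \<in> D"
  and D_diff: "x \<in> D \<Longrightarrow> y \<in> D \<Longrightarrow> x - y \<in> D"
  and D_scale: "x \<in> D \<Longrightarrow> c *\<^sub>R x \<in> D"
  and zero_D: "0 \<in> D"
  using subspace_D by (auto simp: subspace_add subspace_diff subspace_scale subspace_0)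

lemma t_diff: "x \<in> D \<Longrightarrow> y \<in> D \<Longrightarrow> t (x - y) = t x - t y"
  using t_add[of x "(-1) *\<^sub>R y"] t_scale[of y "-1"] D_scale[of y "-1"] by simp

lemma t_zero: "t 0 = 0"
  using t_scale[OF zero_D, of 0] by simp

lemma subspace_graph: "subspace {(x, t x) | x. x \<in> D}"
  by (auto simp: subspace_def zero_prod_def zero_D t_zero D_add t_add D_scale t_scale)

lemma adj_unique: "adj y z \<Longrightarrow> adj y z' \<Longrightarrow> z = z'"
  using orthogonal_dense_eq_0[OF dense_D, of "z - z'"] by (simp add: adj_def inner_diff_right)

lemma A_eqI: "adj (t x) z \<Longrightarrow> A x = z"
  unfolding A_def using adj_unique by blast

lemma E_iff: "x \<in> E \<longleftrightarrow> x \<in> D \<and> adj (t x) (A x)"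
  using A_eqI by (auto simp: E_def)

lemma E_D: "x \<in> E \<Longrightarrow> x \<in> D"
  by (simp add: E_def)

lemma inner_A: "x \<in> E \<Longrightarrow> v \<in> D \<Longrightarrow> inner v (A x) = inner (t v) (t x)"
  by (simp add: E_iff adj_def)

lemma inner_A_left: "x \<in> E \<Longrightarrow> v \<in> D \<Longrightarrow> inner (A x) v = inner (t x) (t v)"
  using inner_A[of x v] by (simp add: inner_commute)

lemma EI: "x \<in> D \<Longrightarrow> adj (t x) z \<Longrightarrow> x \<in> E \<and> A x = z"
  using A_eqI by (auto simp: E_def)

lemma E_add: "x \<in> E \<Longrightarrow> y \<in> E \<Longrightarrow> x + y \<in> E \<and> A (x + y) = A x + A y"
  by (intro EI) (auto simp: E_iff adj_def D_add t_add inner_add_right)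

lemma E_scale: "x \<in> E \<Longrightarrow> c *\<^sub>R x \<in> E \<and> A (c *\<^sub>R x) = c *\<^sub>R A x"
  by (intro EI) (auto simp: E_iff adj_def D_scale t_scale)

lemma E_diff: "x \<in> E \<Longrightarrow> y \<in> E \<Longrightarrow> x - y \<in> E \<and> A (x - y) = A x - A y"
  by (intro EI) (auto simp: E_iff adj_def D_diff t_diff inner_diff_right)

lemma A_symmetric: "x \<in> E \<Longrightarrow> y \<in> E \<Longrightarrow> inner (A x) y = inner x (A y)"
  by (simp add: inner_A inner_A_left E_D)

lemma norm_t_sq: "x \<in> E \<Longrightarrow> (norm (t x))\<^sup>2 = inner (A x) x"
  by (simp add: inner_A_left E_D power2_norm_eq_inner)

text \<open>Von Neumann: split \<open>(h, 0)\<close> along the closed subspace of all \<open>(\<surd>r x, t x)\<close>.\<close>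

lemma A_plus_onto:
  assumes "r > 0"
  obtains x where "x \<in> E" "A x + r *\<^sub>R x = h"
proof -
  define q where "q = sqrt r"
  have q: "q > 0" "q * q = r" using assms by (auto simp: q_def)
  define G where "G = {(q *\<^sub>R x, t x) | x. x \<in> D}"
  \<comment> \<open>Closedness of \<open>G\<close>: it is the preimage of the closed graph under a
    continuous rescaling.\<close>
  have "G = (\<lambda>(u, y). (inverse q *\<^sub>R u, y)) -` {(x, t x) | x. x \<in> D}"
  proof (intro equalityI subsetI)
    fix g assume "g \<in> (\<lambda>(u, y). (inverse q *\<^sub>R u, y)) -` {(x, t x) | x. x \<in> D}"
    then obtain u y where g: "g = (u, y)" "inverse q *\<^sub>R u \<in> D" "y = t (inverse q *\<^sub>R u)"
      by (cases g) auto
    moreover have "u = q *\<^sub>R (inverse q *\<^sub>R u)" using q by simp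
    ultimately show "g \<in> G" unfolding G_def by blast
  qed (use q in \<open>auto simp: G_def\<close>)
  moreover have "closed ((\<lambda>(u, y). (inverse q *\<^sub>R u, y)) -` {(x, t x) | x. x \<in> D})"
    unfolding case_prod_unfold by (intro closed_vimage closed_graph continuous_intros)
  ultimately have "closed G" by simp
  moreover have "subspace G"
    unfolding subspace_def G_def
  proof (intro conjI ballI allI)
    show "0 \<in> {(q *\<^sub>R x, t x) | x. x \<in> D}" using zero_D t_zero by (force simp: zero_prod_def)
  next
    fix g g' assume "g \<in> {(q *\<^sub>R x, t x) | x. x \<in> D}" "g' \<in> {(q *\<^sub>R x, t x) | x. x \<in> D}"
    then obtain x y where "x \<in> D" "g = (q *\<^sub>R x, t x)" "y \<in> D" "g' = (q *\<^sub>R y, t y)" by auto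
    then show "g + g' \<in> {(q *\<^sub>R x, t x) | x. x \<in> D}"
      by (intro CollectI exI[of _ "x + y"]) (simp add: D_add t_add scaleR_add_right)
  next
    fix c g assume "g \<in> {(q *\<^sub>R x, t x) | x. x \<in> D}"
    then obtain x where "x \<in> D" "g = (q *\<^sub>R x, t x)" by auto
    then show "c *\<^sub>R g \<in> {(q *\<^sub>R x, t x) | x. x \<in> D}"
      by (intro CollectI exI[of _ "c *\<^sub>R x"]) (simp add: D_scale t_scale)
  qed
  \<comment> \<open>The factor \<open>inverse q\<close> cancels the \<open>q\<close> in
    \<open>(q *\<^sub>R v, t v)\<close>, and \<open>q * q = r\<close> produces the shift by
    \<open>r\<close>.\<close>
  ultimately obtain g where g: "g \<in> G" "\<And>u. u \<in> G \<Longrightarrow> inner ((inverse q *\<^sub>R h, 0) - g) u = 0"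
    using orthogonal_projection_ex by blast
  then obtain x where x: "x \<in> D" "g = (q *\<^sub>R x, t x)" by (auto simp: G_def)
  have "adj (t x) (h - r *\<^sub>R x)"
    unfolding adj_def
  proof
    fix v assume "v \<in> D"
    then have "inner ((inverse q *\<^sub>R h, 0) - g) (q *\<^sub>R v, t v) = 0"
      by (intro g(2)) (auto simp: G_def)
    then have "inner h v - q * q * inner x v = inner (t x) (t v)"
      using q by (simp add: x inner_diff_left right_diff_distrib mult.assoc[symmetric])
    then show "inner (t v) (t x) = inner v (h - r *\<^sub>R x)"
      by (simp add: q inner_diff_right inner_commute)
  qed
  from EI[OF x(1) this] show thesis by (intro that[of x]) auto
qed

text \<open>\<open>A + r\<close> is onto, so \<open>k\<close> is orthogonal to itself.\<close>

lemma orthogonal_A_plus_eq_0: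
  assumes "r > 0" "\<And>u. u \<in> E \<Longrightarrow> inner k (A u + r *\<^sub>R u) = 0"
  shows "k = 0"
  using A_plus_onto[OF assms(1), of k] assms(2) by (metis inner_eq_zero_iff)

text \<open>Project \<open>(x, t x)\<close> onto the part of the graph inside \<open>M\<close>. The
  residual is \<open>(x - y, t (x - y))\<close>, and its orthogonality to \<open>(u, t u)\<close>
  says that \<open>x - y\<close> is orthogonal to \<open>A u + u\<close>. So \<open>E\<close> is a
  core for \<open>T\<close>.\<close>

lemma E_core:
  assumes "closed M" "subspace M" "\<And>u. u \<in> E \<Longrightarrow> (u, t u) \<in> M" "x \<in> D"
  shows "(x, t x) \<in> M"
proof -
  let ?G = "{(x, t x) | x. x \<in> D}"
  have "closed (M \<inter> ?G)" "subspace (M \<inter> ?G)"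
    using assms closed_graph subspace_graph by (auto intro: subspace_inter closed_Int)
  then obtain m where m: "m \<in> M \<inter> ?G" "\<And>u. u \<in> M \<inter> ?G \<Longrightarrow> inner ((x, t x) - m) u = 0"
    using orthogonal_projection_ex by blast
  then obtain y where y: "y \<in> D" "m = (y, t y)" by auto
  have "x - y = 0"
  proof (rule orthogonal_A_plus_eq_0[of 1])
    fix u assume u: "u \<in> E"
    have "inner ((x, t x) - m) (u, t u) = 0" using assms(3)[OF u] E_D[OF u] by (intro m(2)) auto
    then show "inner (x - y) (A u + 1 *\<^sub>R u) = 0"
      using inner_A[OF u D_diff[OF assms(4) y(1)]] t_diff[OF assms(4) y(1)]
      by (simp add: y inner_add_right)
  qed simp
  then show ?thesis using m y by simp
qed

text \<open>Self-adjointness of \<open>A\<close> in the form used later: the solution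
  \<open>w\<close> of \<open>(A + r) w = (\<gamma> + r) k\<close> differs from \<open>k\<close> by a
  vector orthogonal to the range of \<open>A + r\<close>, so \<open>k = w\<close> lies in
  \<open>E\<close>.\<close>

lemma A_eigenvectorI:
  assumes "\<And>u. u \<in> E \<Longrightarrow> inner k (A u - \<gamma> *\<^sub>R u) = 0"
  shows "k \<in> E \<and> A k = \<gamma> *\<^sub>R k"
proof -
  define r where "r = \<bar>\<gamma>\<bar> + 1"
  have r: "r > 0" by (simp add: r_def)
  obtain w where w: "w \<in> E" "A w + r *\<^sub>R w = (\<gamma> + r) *\<^sub>R k" using A_plus_onto[OF r] by blast
  have "w - k = 0"
  proof (rule orthogonal_A_plus_eq_0[OF r])
    fix u assume u: "u \<in> E"
    have "inner w (A u + r *\<^sub>R u) = inner (A w + r *\<^sub>R w) u"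
      using A_symmetric[OF w(1) u] by (simp add: inner_add)
    also have "\<dots> = (\<gamma> + r) * inner k u" using w(2) by simp
    also have "\<dots> = inner k (A u + r *\<^sub>R u)"
      using assms[OF u] by (simp add: inner_add_right inner_diff_right algebra_simps)
    finally show "inner (w - k) (A u + r *\<^sub>R u) = 0" by (simp add: inner_diff_left)
  qed
  then show ?thesis using w by (auto simp: algebra_simps)
qed

text \<open>Let \<open>m\<close> be the projection of \<open>v\<close> onto the closure and write
  \<open>v - m = (A + 1) u\<close>, \<open>u = (A + 1) w\<close>. Then \<open>w\<close> lies in the
  domain of the square of \<open>A\<close>, and orthogonality of \<open>v - m\<close> to
  \<open>w\<close> reads \<open>inner u u = 0\<close>.\<close>

lemma dense_A_square: "closure {x \<in> E. A x \<in> E} = UNIV"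
proof -
  let ?S = "{x \<in> E. A x \<in> E}"
  have "subspace ?S"
    unfolding subspace_def
    using E_add E_scale E_scale[of _ 0] E_diff[of 0 0] EI[of 0 0]
    by (auto simp: zero_D t_zero adj_def)
  then have S: "subspace (closure ?S)" by (rule subspace_closure)
  have "v \<in> closure ?S" for v
  proof -
    obtain m where m: "m \<in> closure ?S" "\<And>u. u \<in> closure ?S \<Longrightarrow> inner (v - m) u = 0"
      using orthogonal_projection_ex[OF S] by blast
    obtain u where u: "u \<in> E" "A u + 1 *\<^sub>R u = v - m" using A_plus_onto[of 1] by auto
    obtain w where w: "w \<in> E" "A w + 1 *\<^sub>R w = u" using A_plus_onto[of 1] by auto
    have "A w = u - w" using w by (simp add: algebra_simps)
    then have "A w \<in> E" using E_diff u w by simp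
    then have "inner (v - m) w = 0" using w by (intro m(2) closure_subset[THEN subsetD]) auto
    then have "inner (A u) w + inner u w = 0" by (simp add: u(2)[symmetric] inner_add_left)
    then have "inner u (A w + w) = 0" using A_symmetric[OF u(1) w(1)] by (simp add: inner_add_right)
    then have "u = 0" using w by simp
    then have "A u = 0" using E_scale[OF u(1), of 0] by simp
    then show ?thesis using u \<open>u = 0\<close> m(1) by simp
  qed
  then show ?thesis by blast
qed

text \<open>The bound makes the images of a sequence approximating \<open>x\<close> Cauchy, and the
  closed graph puts the limit pair into the graph.\<close>

lemma bounded_if_bounded_on_dense:
  assumes S: "S \<subseteq> D" "closure S = UNIV" "\<And>x. x \<in> S \<Longrightarrow> norm (t x) \<le> K * norm x"
    and sub: "subspace S"
  shows "x \<in> D \<and> norm (t x) \<le> K * norm x"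
proof -
  obtain s where s: "\<And>i. s i \<in> S" "s \<longlonglongrightarrow> x"
    using S(2) closure_sequential[of x S] by auto
  have "Cauchy (\<lambda>i. t (s i))"
  proof (rule metric_CauchyI)
    fix e :: real assume "e > 0"
    \<comment> \<open>\<open>K\<close> may be nonpositive, while a positive constant is needed to
      divide \<open>e\<close>.\<close>
    define K' where "K' = \<bar>K\<bar> + 1"
    have K': "K' > 0" by (simp add: K'_def)
    have "Cauchy s" using s(2) LIMSEQ_imp_Cauchy by blast
    moreover have "e / K' > 0" using \<open>e > 0\<close> K' by simp
    ultimately obtain N where N: "\<forall>i\<ge>N. \<forall>j\<ge>N. dist (s i) (s j) < e / K'"
      using metric_CauchyD by blast
    have "dist (t (s i)) (t (s j)) < e" if "i \<ge> N" "j \<ge> N" for i j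
    proof -
      have "dist (t (s i)) (t (s j)) = norm (t (s i - s j))"
        using s(1) S(1) by (subst t_diff) (auto simp: dist_norm)
      also have "\<dots> \<le> K * norm (s i - s j)" using s(1) sub by (intro S(3)) (auto simp: subspace_diff)
      also have "\<dots> \<le> K' * norm (s i - s j)" by (intro mult_right_mono) (auto simp: K'_def)
      also have "\<dots> < K' * (e / K')"
        using N that K' by (intro mult_strict_left_mono) (auto simp: dist_norm)
      finally show ?thesis using K' by simp
    qed
    then show "\<exists>N. \<forall>i\<ge>N. \<forall>j\<ge>N. dist (t (s i)) (t (s j)) < e" by blast
  qed
  then obtain y where y: "(\<lambda>i. t (s i)) \<longlonglongrightarrow> y" using Cauchy_convergent convergent_def by blast
  have "(\<lambda>i. (s i, t (s i))) \<longlonglongrightarrow> (x, y)" using s(2) y by (rule tendsto_Pair)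
  then have "(x, y) \<in> {(x, t x) | x. x \<in> D}"
    using closed_sequentially[OF closed_graph, of "\<lambda>i. (s i, t (s i))"] s(1) S(1) by blast
  moreover have "norm y \<le> K * norm x"
    using LIMSEQ_le[OF tendsto_norm[OF y] tendsto_mult_left[OF tendsto_norm[OF s(2)], of K]]
      S(3) s(1) by blast
  ultimately show ?thesis by auto
qed

text \<open>Project \<open>(y, z)\<close> onto the graph of \<open>t\<close>. By symmetry the
  residual still satisfies the adjoint relation; tested with \<open>t u\<close> there and with
  \<open>(u, t u)\<close> in the orthogonality, it shows that \<open>y - x\<close> is orthogonal to
  \<open>t (t u) + u = A u + u\<close>.\<close>

lemma symmetric_imp_adj_eq:
  assumes sym: "\<And>x y. x \<in> D \<Longrightarrow> y \<in> D \<Longrightarrow> inner (t x) y = inner x (t y)"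
    and square: "\<And>x. x \<in> E \<Longrightarrow> t x \<in> D"
  shows "adj y z \<longleftrightarrow> y \<in> D \<and> z = t y"
proof
  assume "adj y z"
  obtain g where g: "g \<in> {(x, t x) | x. x \<in> D}"
      "\<And>u. u \<in> {(x, t x) | x. x \<in> D} \<Longrightarrow> inner ((y, z) - g) u = 0"
    using orthogonal_projection_ex[OF subspace_graph closed_graph] by blast
  then obtain x where x: "x \<in> D" "g = (x, t x)" by auto
  have orth: "inner (y - x) v + inner (z - t x) (t v) = 0" if "v \<in> D" for v
    using g(2)[of "(v, t v)"] that by (auto simp: x)
  have adj: "inner (t v) (y - x) = inner v (z - t x)" if "v \<in> D" for v
    using that \<open>adj y z\<close> sym[OF that x(1)] by (simp add: adj_def inner_diff_right)
  have "y - x = 0"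
  proof (rule orthogonal_A_plus_eq_0[of 1])
    fix u assume u: "u \<in> E"
    have "inner v (t (t u)) = inner v (A u)" if "v \<in> D" for v
      using that u square sym E_D by (simp add: inner_A)
    then have "adj (t u) (t (t u))" using u inner_A by (simp add: adj_def)
    then have "A u = t (t u)" by (rule A_eqI)
    then show "inner (y - x) (A u + 1 *\<^sub>R u) = 0"
      using adj[OF square[OF u]] orth[OF E_D[OF u]]
      by (simp add: inner_add_right inner_commute)
  qed simp
  moreover from this have "z - t x = 0"
    using orthogonal_dense_eq_0[OF dense_D, of "z - t x"] adj by auto
  ultimately show "y \<in> D \<and> z = t y" using x by simp
qed (use sym in \<open>auto simp: adj_def\<close>)

section \<open>The resolvent of \<open>A\<close> at \<open>- r\<close>\<close>

definition resolvent :: "real \<Rightarrow> 'a \<Rightarrow> 'a" where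
  "resolvent r h = (SOME x. x \<in> E \<and> A x + r *\<^sub>R x = h)"

lemma resolvent:
  assumes "r > 0"
  shows "resolvent r h \<in> E" "A (resolvent r h) = h - r *\<^sub>R resolvent r h"
proof -
  have "resolvent r h \<in> E \<and> A (resolvent r h) + r *\<^sub>R resolvent r h = h"
    unfolding resolvent_def by (rule someI_ex) (use A_plus_onto[OF assms] in blast)
  then show "resolvent r h \<in> E" "A (resolvent r h) = h - r *\<^sub>R resolvent r h"
    by (auto simp: algebra_simps)
qed

lemma inner_A_plus:
  "x \<in> E \<Longrightarrow> inner (A x + r *\<^sub>R x) x = (norm (t x))\<^sup>2 + r * (norm x)\<^sup>2"
  by (simp add: inner_add_left norm_t_sq) (simp add: power2_norm_eq_inner)

lemma resolvent_eqI:
  assumes "r > 0" "x \<in> E" "A x + r *\<^sub>R x = h"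
  shows "resolvent r h = x"
proof -
  define d where "d = resolvent r h - x"
  have "d \<in> E" "A d + r *\<^sub>R d = 0"
    using E_diff[OF resolvent(1)[OF assms(1), of h] assms(2)] assms resolvent(2)[OF assms(1), of h]
    by (auto simp: d_def algebra_simps)
  then have "(norm (t d))\<^sup>2 + r * (norm d)\<^sup>2 = 0" using inner_A_plus[of d r] by simp
  then have "r * (norm d)\<^sup>2 \<le> 0" by (smt (verit) zero_le_power2)
  then show ?thesis using assms(1) by (simp add: d_def mult_le_0_iff)
qed

text \<open>With \<open>x = resolvent r h\<close>, the energy \<open>inner h x\<close> dominates
  both \<open>r * (norm x)\<^sup>2\<close> and \<open>(norm (t x))\<^sup>2\<close>. The second bound
  lets the resolvent turn forms involving \<open>t\<close> into bounded ones.\<close>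

lemma bounded_linear_resolvent:
  assumes r: "r > 0"
  shows "bounded_linear (resolvent r)" "bounded_linear (\<lambda>h. t (resolvent r h))"
proof -
  have add: "resolvent r (h + k) = resolvent r h + resolvent r k" for h k
    using E_add[OF resolvent(1)[OF r] resolvent(1)[OF r], of h k] resolvent(2)[OF r]
    by (intro resolvent_eqI[OF r]) (auto simp: algebra_simps)
  have scale: "resolvent r (c *\<^sub>R h) = c *\<^sub>R resolvent r h" for c h
    using E_scale[OF resolvent(1)[OF r], of c h] resolvent(2)[OF r]
    by (intro resolvent_eqI[OF r]) (auto simp: algebra_simps)
  have energy: "(norm (t (resolvent r h)))\<^sup>2 + r * (norm (resolvent r h))\<^sup>2
      \<le> norm h * norm (resolvent r h)" for h
    using inner_A_plus[OF resolvent(1)[OF r], of h r] resolvent(2)[OF r, of h]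
      norm_cauchy_schwarz[of h "resolvent r h"] by simp
  have bound: "norm (resolvent r h) \<le> norm h * inverse r" for h
  proof (cases "resolvent r h = 0")
    case False
    have "(r * norm (resolvent r h)) * norm (resolvent r h) \<le> norm h * norm (resolvent r h)"
      using energy[of h] zero_le_power2[of "norm (t (resolvent r h))"]
      unfolding power2_eq_square mult.assoc by linarith
    then have "r * norm (resolvent r h) \<le> norm h" using False by simp
    then show ?thesis using r by (simp add: field_simps)
  qed (use r in simp)
  have "norm (t (resolvent r h)) \<le> norm h * (1 + inverse r)" for h
  proof (rule power2_le_imp_le)
    have "(norm (t (resolvent r h)))\<^sup>2 \<le> norm h * norm (resolvent r h)"
      using energy[of h] mult_nonneg_nonneg[OF less_imp_le[OF r] zero_le_power2[of "norm (resolvent r h)"]]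
      by linarith
    also have "\<dots> \<le> norm h * (norm h * inverse r)" using bound by (intro mult_left_mono) auto
    also have "\<dots> = (norm h)\<^sup>2 * inverse r" by (simp add: power2_eq_square)
    \<comment> \<open>A square above \<open>inverse r\<close>, which avoids a square root in the
      constant.\<close>
    also have "\<dots> \<le> (norm h)\<^sup>2 * (1 + inverse r)\<^sup>2"
      using r by (intro mult_left_mono) (auto simp: power2_eq_square algebra_simps)
    finally show "(norm (t (resolvent r h)))\<^sup>2 \<le> (norm h * (1 + inverse r))\<^sup>2"
      by (simp add: power_mult_distrib)
  qed (use r in simp)
  then show "bounded_linear (\<lambda>h. t (resolvent r h))"
    using resolvent(1)[OF r, THEN E_D]
    by (intro bounded_linear_intro[where K = "1 + inverse r"]) (auto simp: add scale t_add t_scale)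
  show "bounded_linear (resolvent r)"
    using bound by (intro bounded_linear_intro[where K = "inverse r"]) (auto simp: add scale)
qed

text \<open>For fixed \<open>w\<close>, \<open>w'\<close> the condition in \<open>extend\<close> is
  closed and linear in \<open>(v, t v)\<close>, so \<open>E_core\<close> applies, once for each
  argument.\<close>

lemma symmetric_if_symmetric_on_core:
  assumes sym: "\<And>x y. x \<in> E \<Longrightarrow> y \<in> E \<Longrightarrow> inner (t x) y = inner x (t y)"
    and "x \<in> D" "y \<in> D"
  shows "inner (t x) y = inner x (t y)"
proof -
  have extend: "inner (t v) w = inner v w'"
    if "\<And>u. u \<in> E \<Longrightarrow> inner (t u) w = inner u w'" "v \<in> D" for v w w'
  proof -
    have "closed {g. inner (snd g) w = inner (fst g) w'}"
      by (intro closed_Collect_eq continuous_intros)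
    moreover have "subspace {g. inner (snd g) w = inner (fst g) w'}"
      by (simp add: subspace_def inner_add_left)
    ultimately have "(v, t v) \<in> {g. inner (snd g) w = inner (fst g) w'}"
      by (rule E_core) (use that in auto)
    then show ?thesis by simp
  qed
  have "inner (t v) w = inner v (t w)" if "v \<in> D" "w \<in> E" for v w
    by (rule extend) (use that sym in auto)
  then have "inner (t y) x = inner y (t x)"
    by (intro extend[OF _ assms(3)]) (use assms(2) in \<open>metis inner_commute\<close>)
  then show ?thesis by (simp add: inner_commute)
qed

section \<open>Quadratic operators\<close>

text \<open>
  If \<open>T\<close> were multiplication by \<open>z\<close> on a space of functions, \<open>f\<close> below would be multiplication by
  \<open>z - w\<close> with \<open>w\<close> the conjugate of \<open>z\<close>. Modulo \<open>zw = az\<^sup>2 + bz + c = aw\<^sup>2 + bw + c\<close> one has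
  \<open>(1 + a) zw (z - w) = c (z - w)\<close>, so \<open>f\<close> is concentrated on \<open>ker (A - c/(1 + a))\<close>.
\<close>

lemma quadratic_symmetric:
  assumes a: "a > 0" and disc: "4 * a * c \<le> b\<^sup>2"
    and E_square: "\<And>x. x \<in> E \<Longrightarrow> t x \<in> D"
    and A_eq: "\<And>x. x \<in> E \<Longrightarrow> A x = a *\<^sub>R t (t x) + b *\<^sub>R t x + c *\<^sub>R x"
    and comm: "\<And>x. x \<in> E \<Longrightarrow> A x \<in> D \<Longrightarrow> t x \<in> E \<and> A (t x) = t (A x)"
    and "x \<in> D" "y \<in> D"
  shows "inner (t x) y = inner x (t y)"
proof (rule symmetric_if_symmetric_on_core)
  define \<gamma> where "\<gamma> = c / (1 + a)"
  define r where "r = \<bar>\<gamma>\<bar> + 1"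
  define B where "B = resolvent r"
  define f where "f x y = inner (t x) y - inner x (t y)" for x y
  have r: "r > 0" by (simp add: r_def)
  note B = resolvent[OF r, folded B_def]
  have f_skew: "f x y = - f y x" for x y by (simp add: f_def inner_commute)
  have f_add: "f (x + x') y = f x y + f x' y" and f_diff: "f (x - x') y = f x y - f x' y"
    if "x \<in> D" "x' \<in> D" for x x' y
    using that by (simp_all add: f_def t_add t_diff inner_add_left inner_diff_left)
  have f_scale: "f (s *\<^sub>R x) y = s * f x y" if "x \<in> D" for s x y
    using that by (simp add: f_def t_scale algebra_simps)

  \<comment> \<open>Expanding \<open>A y\<close> and \<open>A x\<close> expresses
    \<open>inner (t (t x)) (t y)\<close> and \<open>inner (t x) (t (t y))\<close> through each
    other; subtracting cancels the \<open>b\<close> terms. Commutation identifies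
    \<open>f (A x) y\<close> with \<open>f (t x) (t y)\<close>.\<close>
  have f_A: "f (A x) y = \<gamma> * f x y" if x: "x \<in> E" "A x \<in> D" and y: "y \<in> E" for x y
  proof -
    have tx: "t x \<in> E" "A (t x) = t (A x)" using comm x by auto
    have zw: "inner (t (t x)) (t y) = inner (t x) (A y)" "inner (t x) (t (t y)) = inner (A x) (t y)"
      using x y E_square by (simp_all add: inner_A inner_A_left)
    have "inner (t (t x)) (t y) = a * inner (t x) (t (t y)) + b * inner (t x) (t y) + c * inner (t x) y"
      using zw A_eq[OF y] by (simp add: inner_add_right)
    moreover have "inner (t x) (t (t y)) = a * inner (t (t x)) (t y) + b * inner (t x) (t y) + c * inner x (t y)"
      using zw A_eq[OF x(1)] by (simp add: inner_add_left)
    ultimately have "(1 + a) * f (t x) (t y) = c * f x y"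
      by (simp add: f_def algebra_simps)
    moreover have "f (A x) y = f (t x) (t y)"
      using inner_A_left[OF tx(1) E_D[OF y]] tx(2) zw(2) by (simp add: f_def)
    ultimately show ?thesis using a by (simp add: \<gamma>_def field_simps)
  qed

  \<comment> \<open>This is \<open>f_A\<close> at \<open>B x\<close>, where
    \<open>A (B x) = x - r *\<^sub>R B x\<close>.\<close>
  have f_B: "f x y = (\<gamma> + r) * f (B x) y" if "x \<in> D" "y \<in> E" for x y
  proof -
    have "A (B x) \<in> D" using B that by (simp add: D_diff D_scale E_D)
    then have "f (A (B x)) y = \<gamma> * f (B x) y" using B(1) that(2) by (intro f_A) auto
    then show ?thesis using that(1) E_D[OF B(1)] by (simp add: B(2) f_diff f_scale D_scale algebra_simps)
  qed
  have f_BB: "f x y = (\<gamma> + r)\<^sup>2 * f (B x) (B y)" if "x \<in> E" "y \<in> E" for x y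
    using f_B[of x y] f_B[of y "B x"] f_skew[of y "B x"] f_skew[of "B y" "B x"] that E_D B(1)
    by (simp add: power2_eq_square)

  \<comment> \<open>The null space of the form \<open>f (B h) (B k)\<close>, which is bounded, so
    \<open>M\<close> is closed. By \<open>f_BB\<close>, members of \<open>M\<close> in
    \<open>E\<close> annihilate \<open>E\<close> under \<open>f\<close>.\<close>
  define M where "M = {h. \<forall>k. f (B h) (B k) = 0}"
  have bl: "bounded_linear B" "bounded_linear (\<lambda>h. t (B h))"
    unfolding B_def by (rule bounded_linear_resolvent[OF r])+
  have M_eq: "M = (\<Inter>k. {h. inner (t (B h)) (B k) = inner (B h) (t (B k))})"
    by (auto simp: M_def f_def)
  have "closed M"
    unfolding M_eq
    by (intro closed_INT ballI closed_Collect_eq continuous_intros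
        bounded_linear.continuous_on[OF bl(1)] bounded_linear.continuous_on[OF bl(2)])
  moreover have "subspace M"
    using linear_add[OF bounded_linear.linear[OF bl(1)]] linear_scale[OF bounded_linear.linear[OF bl(1)]]
      linear_0[OF bounded_linear.linear[OF bl(1)]] E_D[OF B(1)]
    by (auto simp: subspace_def M_def f_add f_scale) (simp add: f_def t_zero)
  ultimately have proj: "\<exists>m\<in>M. \<forall>u\<in>M. inner (h - m) u = 0" for h
    using orthogonal_projection_ex[of M h] by metis

  have range_M: "A u - \<gamma> *\<^sub>R u \<in> M" if u: "u \<in> E" for u
  proof -
    have "A u - \<gamma> *\<^sub>R u = (A u + r *\<^sub>R u) - (\<gamma> + r) *\<^sub>R u" by (simp add: algebra_simps)
    then have "B (A u - \<gamma> *\<^sub>R u) = B (A u + r *\<^sub>R u) - (\<gamma> + r) *\<^sub>R B u"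
      using bl(1)[THEN bounded_linear.linear] by (metis linear_diff linear_scale)
    then have "B (A u - \<gamma> *\<^sub>R u) = u - (\<gamma> + r) *\<^sub>R B u"
      using resolvent_eqI[OF r u refl] by (simp add: B_def)
    then show ?thesis
      using f_B[OF E_D[OF u] B(1)] u E_D B(1) by (simp add: M_def f_diff f_scale D_scale)
  qed

  \<comment> \<open>By \<open>range_M\<close>, the orthogonal complement of \<open>M\<close>
    consists of eigenvectors of \<open>A\<close> for \<open>\<gamma>\<close>.\<close>
  have kernel: "k \<in> E \<and> t k = 0" if "\<forall>u\<in>M. inner k u = 0" for k
  proof -
    have k: "k \<in> E" "A k = \<gamma> *\<^sub>R k" using A_eigenvectorI[of k \<gamma>] that range_M by auto
    have tk: "(norm (t k))\<^sup>2 = \<gamma> * (norm k)\<^sup>2"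
      using norm_t_sq[OF k(1)] k(2) by (simp add: power2_norm_eq_inner)
    have "t k = 0"
    proof (cases "k = 0 \<or> \<gamma> \<le> 0")
      case True
      then have "(norm (t k))\<^sup>2 \<le> 0" using tk by (auto simp: mult_le_0_iff)
      then show ?thesis by simp
    next
      \<comment> \<open>For \<open>\<gamma> > 0\<close>, \<open>t\<close> scales norms of
        \<open>k\<close> and \<open>t k\<close> by the root of \<open>\<gamma>\<close>. Comparing
        norms in \<open>a t (t k) = - (b t k + \<gamma> a k)\<close> fixes
        \<open>inner (t k) k\<close>, and Cauchy-Schwarz gives
        \<open>b\<^sup>2 \<le> 4 * a\<^sup>2 * \<gamma>\<close>. But \<open>disc\<close> gives
        \<open>b\<^sup>2 \<ge> 4 * a * c > 4 * a\<^sup>2 * \<gamma>\<close>; it also makes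
        \<open>b\<close> nonzero, so the common factor cancels.\<close>
      case False
      have "\<gamma> * (1 + a) = c" using a by (simp add: \<gamma>_def)
      then have c: "c = \<gamma> + \<gamma> * a" by (simp add: algebra_simps)
      have "t k \<in> E" "A (t k) = \<gamma> *\<^sub>R t k"
        using comm[OF k(1)] k E_D[OF k(1)] by (auto simp: D_scale t_scale)
      then have "(norm (t (t k)))\<^sup>2 = \<gamma> * (norm (t k))\<^sup>2"
        using norm_t_sq[of "t k"] by (simp add: power2_norm_eq_inner)
      then have ttk: "(norm (a *\<^sub>R t (t k)))\<^sup>2 = a\<^sup>2 * (\<gamma>\<^sup>2 * (norm k)\<^sup>2)"
        using tk by (simp add: norm_scaleR power_mult_distrib) (simp add: power2_eq_square)
      have "a *\<^sub>R t (t k) = - (b *\<^sub>R t k + (\<gamma> * a) *\<^sub>R k)"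
        using A_eq[OF k(1)] k(2) c by (simp add: algebra_simps eq_neg_iff_add_eq_0)
      then have "(norm (a *\<^sub>R t (t k)))\<^sup>2 = (norm (b *\<^sub>R t k + (\<gamma> * a) *\<^sub>R k))\<^sup>2"
        by (metis norm_minus_cancel)
      also have "\<dots> = b\<^sup>2 * (norm (t k))\<^sup>2 + 2 * b * \<gamma> * a * inner (t k) k + (\<gamma> * a)\<^sup>2 * (norm k)\<^sup>2"
        unfolding power2_norm_eq_inner
        by (simp add: inner_add inner_commute algebra_simps power2_eq_square)
      finally have "\<gamma> * (b\<^sup>2 * (norm k)\<^sup>2 + 2 * b * a * inner (t k) k) = 0"
        using ttk tk by (simp add: algebra_simps power2_eq_square)
      then have bb: "b\<^sup>2 * (norm k)\<^sup>2 = - (2 * b * a * inner (t k) k)" using False by simp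
      have "(inner (t k) k)\<^sup>2 \<le> (norm (t k))\<^sup>2 * (norm k)\<^sup>2"
        using Cauchy_Schwarz_ineq[of "t k" k] by (simp add: power2_norm_eq_inner)
      then have "4 * b\<^sup>2 * a\<^sup>2 * (inner (t k) k)\<^sup>2 \<le> 4 * b\<^sup>2 * a\<^sup>2 * (\<gamma> * (norm k)\<^sup>2 * (norm k)\<^sup>2)"
        using tk by (intro mult_left_mono) auto
      moreover have "(b\<^sup>2 * (norm k)\<^sup>2)\<^sup>2 = 4 * b\<^sup>2 * a\<^sup>2 * (inner (t k) k)\<^sup>2"
        unfolding bb by (simp add: power_mult_distrib)
      ultimately have "(b\<^sup>2 * (norm k)\<^sup>2)\<^sup>2 \<le> 4 * b\<^sup>2 * a\<^sup>2 * (\<gamma> * (norm k)\<^sup>2 * (norm k)\<^sup>2)"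
        by linarith
      then have "(b\<^sup>2 * (norm k)\<^sup>2 * (norm k)\<^sup>2) * b\<^sup>2 \<le> (b\<^sup>2 * (norm k)\<^sup>2 * (norm k)\<^sup>2) * (4 * a\<^sup>2 * \<gamma>)"
        by (simp only: power2_eq_square[of "b\<^sup>2 * (norm k)\<^sup>2"] mult_ac)
      moreover have pos: "\<gamma> * a > 0" "\<gamma> * a\<^sup>2 > 0" "b\<^sup>2 > 0"
      proof -
        show "\<gamma> * a > 0" "\<gamma> * a\<^sup>2 > 0" using False a by auto
        have "a * c > 0" using False a c by (simp add: add_pos_pos)
        then show "b\<^sup>2 > 0" using disc by linarith
      qed
      ultimately have "b\<^sup>2 \<le> 4 * a\<^sup>2 * \<gamma>" using False by simp
      moreover have "4 * a * c = 4 * (\<gamma> * a) + 4 * a\<^sup>2 * \<gamma>" using c by (simp add: algebra_simps power2_eq_square)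
      ultimately show ?thesis using disc pos by linarith
    qed
    then show ?thesis using k by blast
  qed

  \<comment> \<open>The component of \<open>x\<close> in \<open>M\<close> contributes nothing to
    \<open>f\<close>; what remains is killed by \<open>t\<close>.\<close>
  have reduce: "\<exists>k\<in>E. t k = 0 \<and> (\<forall>y\<in>E. f x y = f k y)" if x: "x \<in> E" for x
  proof -
    obtain m where m: "m \<in> M" "\<forall>u\<in>M. inner (x - m) u = 0" using proj by blast
    have k: "x - m \<in> E" "t (x - m) = 0" using kernel m(2) by auto
    then have mE: "m \<in> E" using E_diff[OF x k(1)] by simp
    have "f x y = f (x - m) y" if "y \<in> E" for y
      using f_BB[OF mE that] m(1) f_diff[OF E_D[OF x] E_D[OF mE]] by (simp add: M_def)
    with k show ?thesis by blast
  qed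
  show "inner (t x) y = inner x (t y)" if xy: "x \<in> E" "y \<in> E" for x y
  proof -
    obtain k where k: "k \<in> E" "t k = 0" "\<forall>y\<in>E. f x y = f k y" using reduce xy(1) by blast
    obtain l where l: "l \<in> E" "t l = 0" "\<forall>v\<in>E. f y v = f l v"
      using reduce xy(2) by blast
    have "f x y = f k y" using k(3) xy(2) by blast
    also have "\<dots> = - f l k" using l(3) k(1) f_skew[of k y] by simp
    also have "\<dots> = 0" by (simp add: f_def k l)
    finally show ?thesis by (simp add: f_def)
  qed
qed (use assms in auto)

section \<open>Powers and boundedness\<close>

text \<open>The domain of the \<open>k\<close>-th power. Since \<open>t\<close> is total,
  \<open>t ^^ k\<close> represents that power only on this set.\<close>

primrec dom_pow :: "nat \<Rightarrow> 'a set" where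
  "dom_pow 0 = UNIV"
| "dom_pow (Suc k) = {x \<in> D. t x \<in> dom_pow k}"

lemma dom_pow_Suc_subset: "dom_pow (Suc k) \<subseteq> dom_pow k"
  by (induction k) auto

lemma dom_pow_antimono: "j \<le> k \<Longrightarrow> x \<in> dom_pow k \<Longrightarrow> x \<in> dom_pow j"
  using lift_Suc_antimono_le[of dom_pow, OF dom_pow_Suc_subset] by blast

lemma dom_pow_add: "x \<in> dom_pow (k + j) \<longleftrightarrow> x \<in> dom_pow k \<and> (t ^^ k) x \<in> dom_pow j"
proof (induction k arbitrary: x)
  case (Suc k)
  then show ?case by (auto simp: funpow_swap1)
qed simp

lemma subspace_dom_pow: "subspace (dom_pow k)"
proof (induction k)
  case (Suc k)
  then show ?case
    by (auto simp: subspace_def zero_D t_zero D_add t_add D_scale t_scale)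
qed simp

lemma norm_t_t:
  assumes "x \<in> E" "A x \<in> D" "t x \<in> E" "A (t x) = t (A x)"
  shows "norm (t (t x)) = norm (A x)"
proof -
  have "(norm (t (t x)))\<^sup>2 = inner (t (A x)) (t x)" using norm_t_sq assms by simp
  also have "\<dots> = (norm (A x))\<^sup>2" using inner_A[OF assms(1,2)] by (simp add: power2_norm_eq_inner)
  finally show ?thesis by (simp add: power2_eq_iff_nonneg)
qed

text \<open>
  By commutation \<open>\<parallel>T\<^sup>2 x\<parallel> = \<parallel>A x\<parallel>\<close>, so the norms of \<open>T\<^sup>k x\<close> are log-convex in \<open>k\<close>: if \<open>\<parallel>T x\<parallel>\<close> is
  large compared with \<open>\<parallel>x\<parallel>\<close>, then \<open>\<parallel>T\<^sup>n x\<parallel>\<close> dominates all lower powers, \<open>\<parallel>A x\<parallel>\<close> included.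
\<close>

lemma bounded_of_growth:
  fixes \<alpha> :: "nat \<Rightarrow> real"
  assumes n: "n \<ge> 3" and E: "E = dom_pow n"
    and comm: "\<And>x. x \<in> dom_pow (Suc n) \<Longrightarrow> A x \<in> D \<and> A (t x) = t (A x)"
    and growth: "\<And>x. x \<in> dom_pow n \<Longrightarrow>
      a * norm ((t ^^ n) x) \<le> norm (A x) + (\<Sum>k<n. \<alpha> k * norm ((t ^^ k) x))"
    and a: "a > 0" and \<alpha>: "\<And>k. \<alpha> k \<ge> 0"
    and x: "x \<in> dom_pow (2 * n)"
  shows "norm (t x) \<le> (1 + (1 + (\<Sum>k<n. \<alpha> k)) / a) * norm x"
proof (rule ccontr)
  \<comment> \<open>Chosen so that \<open>a * R = a + 1 + (\<Sum>k<n. \<alpha> k)\<close>, which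
    beats all terms on the right of \<open>growth\<close>.\<close>
  define R where "R = 1 + (1 + (\<Sum>k<n. \<alpha> k)) / a"
  define m where "m k = norm ((t ^^ k) x)" for k
  assume "\<not> ?thesis"
  then have gt: "m 1 > R * m 0" by (simp add: R_def m_def)
  have R: "R \<ge> 1" using a \<alpha> by (simp add: R_def sum_nonneg)
  have norm2: "norm (t (t y)) = norm (A y)" if "y \<in> dom_pow (Suc n)" for y
    using that comm[OF that] dom_pow_Suc_subset[of n] by (intro norm_t_t) (auto simp: E)
  have convex: "m (Suc k) * m (Suc k) \<le> m k * m (Suc (Suc k))" if "k < n" for k
  proof -
    \<comment> \<open>For \<open>k < n\<close> one has \<open>k + Suc n \<le> 2 * n\<close>, whence
      the domain chosen for \<open>x\<close>.\<close>
    have "x \<in> dom_pow (k + Suc n)" using that by (intro dom_pow_antimono[OF _ x]) auto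
    then have y: "(t ^^ k) x \<in> dom_pow (Suc n)" by (simp only: dom_pow_add)
    then have "(t ^^ k) x \<in> E" using dom_pow_Suc_subset E by blast
    then have "(norm (t ((t ^^ k) x)))\<^sup>2 \<le> norm (A ((t ^^ k) x)) * norm ((t ^^ k) x)"
      using norm_t_sq norm_cauchy_schwarz by metis
    then show ?thesis using norm2[OF y] by (simp add: m_def power2_eq_square mult.commute)
  qed
  \<comment> \<open>Log-convexity propagates the initial ratio \<open>R\<close> to all later
    steps.\<close>
  have grow: "m k > 0 \<and> m (Suc k) \<ge> R * m k" if "k < n" for k
    using that
  proof (induction k)
    case 0
    have "m 0 \<noteq> 0" using gt t_zero by (auto simp: m_def)
    then show ?case using gt by (auto simp: m_def)
  next
    case (Suc k)
    then have IH: "m k > 0" "m (Suc k) \<ge> R * m k" by auto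
    have "m k * (R * m (Suc k)) = R * m k * m (Suc k)" by simp
    also have "\<dots> \<le> m (Suc k) * m (Suc k)" using IH by (intro mult_right_mono) (auto simp: m_def)
    also have "\<dots> \<le> m k * m (Suc (Suc k))" using Suc by (intro convex) auto
    finally have "R * m (Suc k) \<le> m (Suc (Suc k))" using IH by simp
    moreover have "0 < R * m k" using IH R by simp
    ultimately show ?case using IH by linarith
  qed
  have incr: "m k \<le> m n" if "k \<le> n" for k
    using that
  proof (induction k rule: inc_induct)
    case (step k)
    have "1 * m k \<le> R * m k" using R by (intro mult_right_mono) (auto simp: m_def)
    then show ?case using grow[OF step.hyps(2)] step.IH by linarith
  qed simp
  \<comment> \<open>Applied also at \<open>k = 2\<close>, the index of \<open>norm (A x)\<close>;
    there \<open>n \<ge> 3\<close> enters.\<close>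
  have top: "R * m k \<le> m n" if "k < n" for k
    using grow[OF that] incr[of "Suc k"] that by linarith
  have "m n > 0" using grow[of 0] incr[of 0] n by linarith
  have "x \<in> dom_pow n" "x \<in> dom_pow (Suc n)" using n by (auto intro: dom_pow_antimono[OF _ x] simp del: dom_pow.simps)
  then have "a * m n \<le> m 2 + (\<Sum>k<n. \<alpha> k * m k)"
    using growth norm2 by (simp add: m_def numeral_2_eq_2)
  then have "R * (a * m n) \<le> R * (m 2 + (\<Sum>k<n. \<alpha> k * m k))" using R by (intro mult_left_mono) auto
  also have "\<dots> = R * m 2 + (\<Sum>k<n. \<alpha> k * (R * m k))"
    by (simp add: distrib_left sum_distrib_left mult.left_commute)
  also have "\<dots> \<le> m n + (\<Sum>k<n. \<alpha> k * m n)"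
    using top n \<alpha> by (intro add_mono sum_mono mult_left_mono) auto
  also have "\<dots> = (1 + (\<Sum>k<n. \<alpha> k)) * m n" by (simp add: distrib_right sum_distrib_right)
  also have "\<dots> < R * (a * m n)" using \<open>m n > 0\<close> a by (simp add: R_def field_simps)
  finally show False by simp
qed

text \<open>If the bound failed, \<open>norm x \<le> norm (t x)\<close>, and
  \<open>(norm (t x))\<^sup>2 = inner (A x) x\<close> would be at most
  \<open>(\<alpha> + \<beta>) * norm (t x) * norm x\<close>; cancel \<open>norm (t x)\<close>. This
  serves degree one.\<close>

lemma bounded_of_linear_growth:
  assumes "x \<in> E" "norm (A x) \<le> \<alpha> * norm (t x) + \<beta> * norm x" "\<alpha> \<ge> 0" "\<beta> \<ge> 0"
  shows "norm (t x) \<le> (\<alpha> + \<beta> + 1) * norm x"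
proof (rule ccontr)
  define K where "K = \<alpha> + \<beta> + 1"
  assume "\<not> ?thesis"
  then have gt: "K * norm x < norm (t x)" by (simp add: K_def)
  have "1 * norm x \<le> K * norm x" using assms by (intro mult_right_mono) (auto simp: K_def)
  then have le: "norm x \<le> norm (t x)" using gt by linarith
  have "norm (t x) * norm (t x) \<le> norm (A x) * norm x"
    using norm_t_sq[OF assms(1)] norm_cauchy_schwarz[of "A x" x] by (simp add: power2_eq_square)
  also have "\<dots> \<le> (\<alpha> * norm (t x) + \<beta> * norm (t x)) * norm x"
    using assms(2) mult_left_mono[OF le assms(4)] by (intro mult_right_mono) auto
  also have "\<dots> \<le> norm (t x) * (K * norm x)" by (simp add: K_def algebra_simps)
  finally have "norm (t x) * norm (t x) \<le> norm (t x) * (K * norm x)" .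
  moreover have "norm (t x) > 0" using gt le by (smt (verit) norm_ge_zero mult_nonneg_nonneg K_def assms(3,4))
  ultimately show False using gt by simp
qed

end

section \<open>Complex operators and polynomials\<close>

lemma scaleC_one: "1 *\<^sub>C (x :: 'a::complex_inner) = x"
  using scaleC_of_real[of 1 x] by simp

lemma norm_scaleC: "norm (a *\<^sub>C (x :: 'a::complex_inner)) = cmod a * norm x"
proof -
  have "cinner x (a *\<^sub>C x) = cnj (a * cinner x x)"
    unfolding cinner_commute[of x "a *\<^sub>C x"] cinner_scaleC_left ..
  also have "\<dots> = cnj a * cinner x x"
    unfolding complex_cnj_mult cinner_commute[of x x, symmetric] ..
  finally have "cinner (a *\<^sub>C x) (a *\<^sub>C x) = a * (cnj a * cinner x x)"
    unfolding cinner_scaleC_left by (rule arg_cong)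
  then show ?thesis
    by (simp add: norm_eq_sqrt_cinner[of x] norm_eq_sqrt_cinner[of "a *\<^sub>C x"] norm_mult real_sqrt_mult)
qed

text \<open>Multiplying by \<open>\<i>\<close> moves the imaginary part, up to sign, into the real
  part.\<close>

lemma cinner_eq_iff_inner:
  fixes w x y z :: "'a::complex_inner"
  shows "cinner w y = cinner x z \<longleftrightarrow>
    inner w y = inner x z \<and> inner (\<i> *\<^sub>C w) y = inner (\<i> *\<^sub>C x) z"
  by (auto simp: inner_eq_Re_cinner cinner_scaleC_left complex_eq_iff)

lemma relpow_mem_iff:
  fixes T :: "('a \<times> 'a) set"
  assumes sv: "single_valued T"
  shows "(x, y) \<in> T ^^ k \<longleftrightarrow> x \<in> Domain (T ^^ k) \<and> y = ((\<lambda>x. THE y. (x, y) \<in> T) ^^ k) x"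
proof -
  have the: "(THE y. (x, y) \<in> T) = y" if "(x, y) \<in> T" for x y
    using that sv by (auto dest: single_valuedD)
  have "(x, y) \<in> T ^^ k \<Longrightarrow> y = ((\<lambda>x. THE y. (x, y) \<in> T) ^^ k) x" for x y
  proof (induction k arbitrary: y)
    case (Suc k)
    then obtain z where "(x, z) \<in> T ^^ k" "(z, y) \<in> T" by auto
    then show ?case using Suc.IH the by auto
  qed simp
  then show ?thesis by blast
qed

section \<open>Complex operators given by graphs\<close>

locale hilbert_op =
  fixes T :: "'a::complex_hilbert op"
  assumes linear: "linear_op T" and dense: "densely_defined T" and closed: "closed T"
begin

definition t :: "'a \<Rightarrow> 'a" where "t x = (THE y. (x, y) \<in> T)"

lemma single_valued: "single_valued T"
  using linear by (simp add: linear_op_def)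

lemma mem_iff: "(x, y) \<in> T \<longleftrightarrow> x \<in> Domain T \<and> y = t x"
  using relpow_mem_iff[OF single_valued, of x y 1] by (simp add: t_def)

lemma T_eq: "T = {(x, t x) | x. x \<in> Domain T}"
  using mem_iff by auto

lemma D_add: "x \<in> Domain T \<Longrightarrow> y \<in> Domain T \<Longrightarrow> x + y \<in> Domain T \<and> t (x + y) = t x + t y"
  using linear mem_iff[of x "t x"] mem_iff[of y "t y"] mem_iff[of "x + y" "t x + t y"]
  unfolding linear_op_def by auto

lemma D_scaleC: "x \<in> Domain T \<Longrightarrow> c *\<^sub>C x \<in> Domain T \<and> t (c *\<^sub>C x) = c *\<^sub>C t x"
  using linear mem_iff[of x "t x"] mem_iff[of "c *\<^sub>C x" "c *\<^sub>C t x"]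
  unfolding linear_op_def by auto

lemma zero_D: "0 \<in> Domain T"
  using linear unfolding linear_op_def by blast

sublocale closed_operator "Domain T" t
proof
  show "subspace (Domain T)"
    using D_add D_scaleC[of _ "complex_of_real _"] zero_D
    unfolding subspace_def scaleC_of_real by blast
  show "t (x + y) = t x + t y" if "x \<in> Domain T" "y \<in> Domain T" for x y
    using D_add that by blast
  show "t (c *\<^sub>R x) = c *\<^sub>R t x" if "x \<in> Domain T" for c x
    using D_scaleC[OF that, of "complex_of_real c"] by (simp add: scaleC_of_real)
  show "closed {(x, t x) | x. x \<in> Domain T}" using closed T_eq by simp
  show "closure (Domain T) = UNIV" using dense by (simp add: densely_defined_def)
qed

text \<open>The domain is invariant under \<open>\<i>\<close>, so the real adjoint relation, tested
  with \<open>\<i> *\<^sub>C x\<close> as well, recovers the complex one.\<close>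

lemma op_adj_iff: "(y, z) \<in> op_adj T \<longleftrightarrow> adj y z"
proof
  assume "(y, z) \<in> op_adj T"
  then show "adj y z" by (auto simp: op_adj_def adj_def mem_iff inner_eq_Re_cinner)
next
  assume "adj y z"
  then have "cinner (t x) y = cinner x z" if "x \<in> Domain T" for x
  proof -
    have "\<i> *\<^sub>C x \<in> Domain T" "t (\<i> *\<^sub>C x) = \<i> *\<^sub>C t x" using D_scaleC[OF that] by auto
    with \<open>adj y z\<close> that show ?thesis unfolding adj_def cinner_eq_iff_inner by metis
  qed
  then show "(y, z) \<in> op_adj T"
    using mem_iff by (auto simp: op_adj_def)
qed

lemma gram_iff: "(x, z) \<in> op_adj T \<cdot>\<^sub>o T \<longleftrightarrow> x \<in> E \<and> z = A x"
  using EI by (auto simp: op_mult_def relcomp_unfold mem_iff op_adj_iff E_iff)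

lemma Domain_relpow: "Domain (T ^^ k) = dom_pow k"
proof (induction k)
  case (Suc k)
  have "Domain (T ^^ Suc k) = {x. \<exists>y. (x, y) \<in> T \<and> y \<in> Domain (T ^^ k)}"
    unfolding relpow.simps(2) relpow_commute[symmetric] by blast
  then show ?case using Suc by (auto simp: mem_iff)
qed simp

lemma relpow_iff: "(x, y) \<in> T ^^ k \<longleftrightarrow> x \<in> dom_pow k \<and> y = (t ^^ k) x"
  using relpow_mem_iff[OF single_valued, of x y k] by (simp add: Domain_relpow t_def[abs_def])

lemma dom_pow_scaleC: "x \<in> dom_pow k \<Longrightarrow> c *\<^sub>C x \<in> dom_pow k"
  by (induction k arbitrary: x) (auto simp: D_scaleC)

lemma dom_pow_scaleC_iff: "c \<noteq> 0 \<Longrightarrow> c *\<^sub>C x \<in> dom_pow k \<longleftrightarrow> x \<in> dom_pow k"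
  using dom_pow_scaleC[of x k c] dom_pow_scaleC[of "c *\<^sub>C x" k "inverse c"]
  by (auto simp: scaleC_scaleC scaleC_one)

lemma t_sum: "(\<And>i. i \<in> I \<Longrightarrow> f i \<in> Domain T) \<Longrightarrow> t (\<Sum>i\<in>I. f i) = (\<Sum>i\<in>I. t (f i))"
  by (induction I rule: infinite_finite_induct)
    (auto simp: t_zero t_add subspace_sum[OF subspace_D])

section \<open>Polynomials of an operator\<close>

definition poly_op :: "complex poly \<Rightarrow> 'a \<Rightarrow> 'a" where
  "poly_op p x = (\<Sum>k\<le>degree p. coeff p k *\<^sub>C (t ^^ k) x)"

lemma op_poly_iff: "(x, z) \<in> op_poly p T \<longleftrightarrow> x \<in> dom_pow (degree p) \<and> z = poly_op p x"
proof
  assume "(x, z) \<in> op_poly p T"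
  then show "x \<in> dom_pow (degree p) \<and> z = poly_op p x"
    by (auto simp: op_poly_def relpow_iff poly_op_def)
next
  assume "x \<in> dom_pow (degree p) \<and> z = poly_op p x"
  then show "(x, z) \<in> op_poly p T"
    by (auto simp: op_poly_def relpow_iff poly_op_def intro!: exI[of _ "\<lambda>k. (t ^^ k) x"] intro: dom_pow_antimono)
qed

lemma dom_pow_power: "x \<in> dom_pow n \<Longrightarrow> k + j \<le> n \<Longrightarrow> (t ^^ k) x \<in> dom_pow j"
  using dom_pow_add dom_pow_antimono by blast

text \<open>Solve for the leading term: if \<open>x\<close> is in
  \<open>dom_pow (degree p + j)\<close>, all lower powers of \<open>t\<close> send it into
  \<open>dom_pow (Suc j)\<close>, hence so does the top one.\<close>

lemma poly_op_in_dom_pow: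
  assumes "x \<in> dom_pow (degree p)" "poly_op p x \<in> dom_pow j" "degree p \<ge> 1"
  shows "x \<in> dom_pow (degree p + j)"
  using assms(2)
proof (induction j)
  case (Suc j)
  let ?n = "degree p"
  have x: "x \<in> dom_pow (?n + j)" using Suc dom_pow_Suc_subset by blast
  have "(\<Sum>k<?n. coeff p k *\<^sub>C (t ^^ k) x) \<in> dom_pow (Suc j)"
    using dom_pow_power[OF x] by (intro subspace_sum[OF subspace_dom_pow] dom_pow_scaleC) (auto simp del: dom_pow.simps)
  then have "poly_op p x - (\<Sum>k<?n. coeff p k *\<^sub>C (t ^^ k) x) \<in> dom_pow (Suc j)"
    using Suc(2) by (intro subspace_diff[OF subspace_dom_pow])
  then have "coeff p ?n *\<^sub>C (t ^^ ?n) x \<in> dom_pow (Suc j)"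
    by (simp add: poly_op_def lessThan_Suc_atMost[symmetric] del: dom_pow.simps)
  moreover have "coeff p ?n \<noteq> 0" using assms(3) by auto
  ultimately have "(t ^^ ?n) x \<in> dom_pow (Suc j)" using dom_pow_scaleC_iff by blast
  then show ?case using assms(1) by (simp only: dom_pow_add)
qed (use assms in auto)

lemma poly_op_t:
  assumes "x \<in> dom_pow (Suc (degree p))"
  shows "poly_op p x \<in> Domain T" "t (poly_op p x) = poly_op p (t x)"
proof -
  have pow: "(t ^^ k) x \<in> Domain T" if "k \<le> degree p" for k
    using dom_pow_power[OF assms, of k 1] that by simp
  then show "poly_op p x \<in> Domain T"
    using D_scaleC by (auto simp: poly_op_def intro!: subspace_sum[OF subspace_D])
  show "t (poly_op p x) = poly_op p (t x)"
    using pow D_scaleC unfolding poly_op_def by (subst t_sum) (auto simp: funpow_swap1)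
qed

end

section \<open>Quadratic polynomials with real preimages of the half-line\<close>

lemma poly_2_eq:
  fixes p :: "complex poly"
  assumes "degree p = 2"
  shows "poly p z = coeff p 2 * z\<^sup>2 + coeff p 1 * z + coeff p 0"
  by (simp add: poly_altdef assms numeral_2_eq_2 algebra_simps)

text \<open>For every \<open>s \<ge> 0\<close> both roots of \<open>a z^2 + b z + c = s\<close> are
  real. Their sum makes \<open>b / a\<close> real; their difference makes
  \<open>(b / a)^2 - 4 c / a + 4 s / a\<close> real and nonnegative. Comparing \<open>s = 0\<close>
  with \<open>s = 1\<close> makes \<open>1 / a\<close> real, a large \<open>s\<close> makes it
  positive, and \<open>s = 0\<close> gives the discriminant inequality.\<close>

lemma real_preimage_coeffs:
  fixes a b c :: complex
  assumes a: "a \<noteq> 0"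
    and real: "\<And>z s. s \<ge> 0 \<Longrightarrow> a * z\<^sup>2 + b * z + c = complex_of_real s \<Longrightarrow> z \<in> \<real>"
  obtains a' b' c' where "a = complex_of_real a'" "b = complex_of_real b'" "c = complex_of_real c'"
    "a' > 0" "4 * a' * c' \<le> b'\<^sup>2"
proof -
  define q where "q s = csqrt (b\<^sup>2 - 4 * a * (c - complex_of_real s))" for s
  have q: "(q s)\<^sup>2 = b\<^sup>2 - 4 * a * (c - complex_of_real s)" for s by (simp add: q_def)
  have roots: "(- b + q s) / (2 * a) \<in> \<real>" "(- b - q s) / (2 * a) \<in> \<real>" if "s \<ge> 0" for s
  proof -
    have "a * z\<^sup>2 + b * z + c = complex_of_real s"
      if "2 * a * z + b = q s \<or> 2 * a * z + b = - q s" for z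
    proof -
      have "(2 * a * z + b)\<^sup>2 = b\<^sup>2 - 4 * a * (c - complex_of_real s)" using that q by auto
      then have "4 * a * (a * z\<^sup>2 + b * z + c - complex_of_real s) = 0"
        by (simp add: power2_eq_square algebra_simps)
      then show ?thesis using a by simp
    qed
    then have "z \<in> \<real>" if "2 * a * z + b = q s \<or> 2 * a * z + b = - q s" for z
      using real[OF \<open>s \<ge> 0\<close>] that by blast
    then show "(- b + q s) / (2 * a) \<in> \<real>" "(- b - q s) / (2 * a) \<in> \<real>"
      using a by simp_all
  qed
  have diff: "q s / a \<in> \<real>" if "s \<ge> 0" for s
    using Reals_diff[OF roots[OF that]] a by (simp add: field_simps)
  have "b / a \<in> \<real>"
    using Reals_minus[OF Reals_add[OF roots[of 0]]] a by (simp add: field_simps)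
  then obtain \<beta> where \<beta>: "b / a = complex_of_real \<beta>" by (rule Reals_cases)
  have sq: "\<exists>d. (q s / a)\<^sup>2 = complex_of_real d \<and> d \<ge> 0" if "s \<ge> 0" for s
  proof -
    obtain y where "q s / a = complex_of_real y" using diff[OF \<open>s \<ge> 0\<close>] by (rule Reals_cases)
    then show ?thesis by (intro exI[of _ "y\<^sup>2"]) simp
  qed
  have quot: "(q s / a)\<^sup>2 = (b / a)\<^sup>2 - 4 * (c / a) + 4 * complex_of_real s / a" for s
    using a by (simp add: power_divide q) (simp add: field_simps power2_eq_square)
  obtain d0 where d0: "(b / a)\<^sup>2 - 4 * (c / a) = complex_of_real d0" "d0 \<ge> 0"
    using sq[of 0] quot[of 0] by auto
  obtain d1 where d1: "complex_of_real d0 + 4 / a = complex_of_real d1"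
    using sq[of 1] quot[of 1] d0 by auto
  define e where "e = (d1 - d0) / 4"
  have e: "1 / a = complex_of_real e" using d1 by (simp add: e_def field_simps)
  then have e0: "e \<noteq> 0" using a by auto
  have a_eq: "a = complex_of_real (1 / e)" using e e0 a by (simp add: field_simps)
  have e_pos: "e > 0"
  proof (rule ccontr)
    assume "\<not> e > 0"
    then have neg: "e < 0" using e0 by simp
    \<comment> \<open>With this \<open>s\<close> the scaled discriminant
      \<open>d0 + 4 * s * e\<close> equals \<open>- 1\<close>.\<close>
    define s where "s = (d0 + 1) / (- 4 * e)"
    have "s \<ge> 0" unfolding s_def using neg d0(2) by (intro divide_nonneg_nonneg) auto
    then obtain d where d: "(q s / a)\<^sup>2 = complex_of_real d" "d \<ge> 0" using sq by blast
    have "complex_of_real d = complex_of_real d0 + 4 * complex_of_real s * (1 / a)"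
      using d(1) quot[of s] d0(1) by simp
    also have "\<dots> = complex_of_real (d0 + 4 * s * e)" by (simp add: e)
    finally have "d = d0 + 4 * s * e" using of_real_eq_iff by blast
    also have "\<dots> = - 1" using neg by (simp add: s_def field_simps)
    finally show False using d(2) by simp
  qed
  have b_eq: "b = complex_of_real (\<beta> / e)" using \<beta> a a_eq by (simp add: field_simps)
  have "4 * (c / a) = complex_of_real (\<beta>\<^sup>2 - d0)" using d0(1) \<beta> by (simp add: algebra_simps)
  then have c_eq: "c = complex_of_real ((\<beta>\<^sup>2 - d0) / 4 / e)" using a a_eq by (simp add: field_simps)
  show thesis
  proof (rule that[OF a_eq b_eq c_eq])
    show "1 / e > 0" using e_pos by simp
    have "4 * (1 / e) * ((\<beta>\<^sup>2 - d0) / 4 / e) = (\<beta>\<^sup>2 - d0) / e\<^sup>2"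
      using e_pos by (simp add: power2_eq_square field_simps)
    also have "\<dots> \<le> (\<beta> / e)\<^sup>2"
      unfolding power_divide using d0(2) by (intro divide_right_mono) auto
    finally show "4 * (1 / e) * ((\<beta>\<^sup>2 - d0) / 4 / e) \<le> (\<beta> / e)\<^sup>2" .
  qed
qed

section \<open>Operators with \<open>T\<^sup>* T = p(T)\<close>\<close>

theorem theorem6p6:
  fixes T :: "'a::complex_hilbert op" and p :: "complex poly" and n :: nat
  assumes "linear_op T"
    and "densely_defined T"
    and "closed T"
    and "degree p = n"
    and "n \<ge> 1"
    and "op_adj T \<cdot>\<^sub>o T = op_poly p T"
  shows "quasinormal_op T \<and>
         (n \<noteq> 2 \<longrightarrow> bounded_op T) \<and>
         (n = 2 \<longrightarrow>
            (\<forall>z. poly p z \<in> \<real> \<and> Re (poly p z) \<ge> 0 \<longrightarrow> z \<in> \<real>) \<longrightarrow>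
            self_adjoint_op T)"
proof (intro conjI impI)
  interpret hilbert_op T using assms by unfold_locales
  have iff: "x \<in> E \<and> z = A x \<longleftrightarrow> x \<in> dom_pow n \<and> z = poly_op p x" for x z
    using assms(4,6) gram_iff[of x z] op_poly_iff[of x z p] by simp
  have E: "E = dom_pow n" using iff by blast
  have A_eq: "A x = poly_op p x" if "x \<in> dom_pow n" for x using iff that by blast
  have A_in_dom_pow: "x \<in> dom_pow (n + j)" if "x \<in> dom_pow n" "A x \<in> dom_pow j" for x j
    using poly_op_in_dom_pow[of x p j] that A_eq assms(4,5) by simp
  have commute: "A x \<in> Domain T \<and> A (t x) = t (A x)" if "x \<in> dom_pow (Suc n)" for x
  proof -
    have "x \<in> dom_pow n" "t x \<in> dom_pow n" using that dom_pow_Suc_subset by auto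
    then show ?thesis using poly_op_t[of x p] that A_eq assms(4) by simp
  qed

  show "quasinormal_op T"
  proof -
    have "(x, z) \<in> T \<cdot>\<^sub>o op_adj T \<cdot>\<^sub>o T \<longleftrightarrow> (x, z) \<in> op_adj T \<cdot>\<^sub>o T \<cdot>\<^sub>o T" for x z
    proof -
      \<comment> \<open>Regrouped as \<open>T A\<close> and \<open>A T\<close>. Both have domain
        \<open>dom_pow (Suc n)\<close>: for \<open>T A\<close> because \<open>A x\<close> in the
        domain of \<open>T\<close> forces one more power on \<open>x\<close>.\<close>
      have "(x, z) \<in> T \<cdot>\<^sub>o op_adj T \<cdot>\<^sub>o T \<longleftrightarrow> (\<exists>y. (x, y) \<in> op_adj T \<cdot>\<^sub>o T \<and> (y, z) \<in> T)"
        by (auto simp: op_mult_def)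
      also have "\<dots> \<longleftrightarrow> x \<in> dom_pow (Suc n) \<and> z = t (A x)"
        using A_in_dom_pow[of x 1] commute[of x] dom_pow_Suc_subset[of n] by (auto simp: gram_iff mem_iff E)
      also have "\<dots> \<longleftrightarrow> (\<exists>y. (x, y) \<in> T \<and> (y, z) \<in> op_adj T \<cdot>\<^sub>o T)"
        using commute[of x] by (auto simp: gram_iff mem_iff E)
      also have "\<dots> \<longleftrightarrow> (x, z) \<in> op_adj T \<cdot>\<^sub>o T \<cdot>\<^sub>o T" by (auto simp: op_mult_def)
      finally show ?thesis .
    qed
    then show ?thesis using assms by (auto simp: quasinormal_op_def)
  qed

  show "bounded_op T" if "n \<noteq> 2"
  proof -
    have deg: "degree p = n" "coeff p n \<noteq> 0" using assms(4,5) by auto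
    define \<alpha> where "\<alpha> k = cmod (coeff p k)" for k
    have sum: "A x = coeff p n *\<^sub>C (t ^^ n) x + (\<Sum>k<n. coeff p k *\<^sub>C (t ^^ k) x)"
      if "x \<in> dom_pow n" for x
      using A_eq[OF that] by (simp add: poly_op_def deg lessThan_Suc_atMost[symmetric] add.commute)
    have rest: "norm (\<Sum>k<n. coeff p k *\<^sub>C (t ^^ k) x) \<le> (\<Sum>k<n. \<alpha> k * norm ((t ^^ k) x))" for x
      by (rule order_trans[OF norm_sum]) (simp add: norm_scaleC \<alpha>_def)
    have "\<exists>K. \<forall>x\<in>dom_pow (2 * n). norm (t x) \<le> K * norm x"
    proof (cases "n = 1")
      case True
      have "norm (t x) \<le> (\<alpha> n + \<alpha> 0 + 1) * norm x" if "x \<in> dom_pow (2 * n)" for x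
      proof (rule bounded_of_linear_growth)
        have x: "x \<in> dom_pow n" using that by (rule dom_pow_antimono[rotated]) simp
        show "x \<in> E" using x E by simp
        show "norm (A x) \<le> \<alpha> n * norm (t x) + \<alpha> 0 * norm x"
          using sum[OF x] norm_triangle_ineq[of "coeff p 1 *\<^sub>C t x" "coeff p 0 *\<^sub>C x"] True
          by (simp add: norm_scaleC \<alpha>_def)
      qed (auto simp: \<alpha>_def)
      then show ?thesis by blast
    next
      case False
      have "norm (t x) \<le> (1 + (1 + (\<Sum>k<n. \<alpha> k)) / \<alpha> n) * norm x" if "x \<in> dom_pow (2 * n)" for x
      proof (rule bounded_of_growth[OF _ E commute _ _ _ that])
        show "n \<ge> 3" using False \<open>n \<noteq> 2\<close> assms(5) by simp
        show "\<alpha> n * norm ((t ^^ n) x) \<le> norm (A x) + (\<Sum>k<n. \<alpha> k * norm ((t ^^ k) x))"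
          if "x \<in> dom_pow n" for x
        proof -
          have "\<alpha> n * norm ((t ^^ n) x) = norm (A x - (\<Sum>k<n. coeff p k *\<^sub>C (t ^^ k) x))"
            using sum[OF that] by (simp add: norm_scaleC \<alpha>_def)
          also have "\<dots> \<le> norm (A x) + norm (\<Sum>k<n. coeff p k *\<^sub>C (t ^^ k) x)"
            by (rule norm_triangle_ineq4)
          finally show ?thesis using rest[of x] by linarith
        qed
      qed (use deg in \<open>auto simp: \<alpha>_def\<close>)
      then show ?thesis by blast
    qed
    then obtain K where K: "\<And>x. x \<in> dom_pow (2 * n) \<Longrightarrow> norm (t x) \<le> K * norm x" by blast
    \<comment> \<open>The growth bounds hold on \<open>dom_pow (2 * n)\<close>, which is dense
      because it contains the domain of the square of \<open>A\<close>.\<close>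
    have "{x \<in> E. A x \<in> E} \<subseteq> dom_pow (2 * n)" using A_in_dom_pow[of _ n] by (auto simp: E mult_2)
    then have dense: "closure (dom_pow (2 * n)) = UNIV"
      using closure_mono dense_A_square by blast
    have "dom_pow (2 * n) \<subseteq> dom_pow 1" using dom_pow_antimono[of 1 "2 * n"] assms(5) by auto
    then have "dom_pow (2 * n) \<subseteq> Domain T" by simp
    from bounded_if_bounded_on_dense[OF this dense K subspace_dom_pow]
    have "x \<in> Domain T \<and> norm (t x) \<le> K * norm x" for x .
    then show ?thesis using assms(1) unfolding bounded_op_def by (auto simp: mem_iff intro!: exI[of _ K])
  qed

  show "self_adjoint_op T"
    if "n = 2" and real: "\<forall>z. poly p z \<in> \<real> \<and> Re (poly p z) \<ge> 0 \<longrightarrow> z \<in> \<real>"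
  proof -
    have "degree p = 2" using assms(4) \<open>n = 2\<close> by simp
    moreover from this have "coeff p 2 \<noteq> 0" by (metis leading_coeff_0_iff degree_0 zero_neq_numeral)
    ultimately obtain a b c where coeffs: "coeff p 2 = complex_of_real a" "coeff p 1 = complex_of_real b"
        "coeff p 0 = complex_of_real c" and abc: "a > 0" "4 * a * c \<le> b\<^sup>2"
      using real_preimage_coeffs[of "coeff p 2" "coeff p 1" "coeff p 0"] real
      by (auto simp: poly_2_eq)
    \<comment> \<open>For \<open>n = 2\<close>, \<open>E\<close> is the domain of the square of
      \<open>T\<close>.\<close>
    have square: "t x \<in> Domain T" if "x \<in> E" for x
      using that E \<open>n = 2\<close> by (simp add: numeral_2_eq_2)
    have "inner (t x) y = inner x (t y)" if "x \<in> Domain T" "y \<in> Domain T" for x y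
    proof (rule quadratic_symmetric[OF abc square _ _ that])
      show "A x = a *\<^sub>R t (t x) + b *\<^sub>R t x + c *\<^sub>R x" if "x \<in> E" for x
        using A_eq that coeffs E \<open>n = 2\<close> assms(4)
        by (simp add: poly_op_def numeral_2_eq_2 scaleC_of_real)
      show "t x \<in> E \<and> A (t x) = t (A x)" if "x \<in> E" "A x \<in> Domain T" for x
        using A_in_dom_pow[of x 1] commute[of x] that by (auto simp: E)
    qed
    then have "adj y z \<longleftrightarrow> y \<in> Domain T \<and> z = t y" for y z
      using symmetric_imp_adj_eq square by blast
    then show ?thesis using assms(1,2) by (auto simp: self_adjoint_op_def op_adj_iff mem_iff)
  qed
qed

end
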